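(* Let $C$ be a clutter with finite vertex set $X$, and let $W$ be a minimal vertex cover of $\mathcal{J}_s(C)$ for some $s\in\mathbb{N}$. If $x\in X$ and $x_i\in W$ for some $i\in\{0,\dots,s\}$, then $x_j\in W$ for every $j\in\{0,\dots,i\}$.
   Context: $\mathbb{N}$ includes $0$. A clutter $C$ with vertex set $X$ is a family $E(C)$ of subsets of $X$ (edges), none of which is contained in another. A vertex cover of a clutter is a set of vertices meeting every edge; it is minimal if no proper subset is a vertex cover. For a field $\Bbbk$, $\Bbbk[X]$ is the polynomial ring with the elements of $X$ as variables; the edge ideal $I(C)\subseteq\Bbbk[X]$ is generated by the monomials $x_1\cdots x_r$ with $\{x_1,\dots,x_r\}\in E(C)$. For $s\in\mathbb{N}$ let $\mathcal{J}_s(X)=\bigcup_{x\in X}\{x_0,\dots,x_s\}$ (new distinct variables), and let $\phi_s\colon\Bbbk[X]\to\Bbbk[\mathcal{J}_s(X)][t]/\langle t^{s+1}\rangle$ be the $\Bbbk$-algebra homomorphism with $\phi_s(x)=\sum_{j=0}^s x_jt^j$. For an ideal $I=\langle f_1,\dots,f_r\rangle$ of $\Bbbk[X]$, the ideal of $s$-jets $\mathcal{J}_s(I)\subseteq\Bbbk[\mathcal{J}_s(X)]$ is generated by the $f_{i,j}$ determined by $\phi_s(f_i)=\sum_{j=0}^s f_{i,j}t^j$. The clutter of $s$-jets $\mathcal{J}_s(C)$ is the clutter with vertex set $\mathcal{J}_s(X)$ whose edge ideal is $\sqrt{\mathcal{J}_s(I(C))}$. By a known theorem of Goward and Smith, this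 means that the edges of $\mathcal{J}_s(C)$ are exactly the sets $\{x_{1,i_1},\dots,x_{r,i_r}\}$ with $\{x_1,\dots,x_r\}$ an edge of $C$ (the $x_j$ distinct) and $i_1,\dots,i_r\in\mathbb{N}$, $i_1+\dots+i_r\le s$. *)

theory Defs
  imports
    "HOL-Library.Poly_Mapping"
    "HOL-Computational_Algebra.Polynomial"
    "HOL-Algebra.Ideal"
begin

definition clutter :: "'a set \<Rightarrow> 'a set set \<Rightarrow> bool" where
  "clutter V E \<longleftrightarrow> (\<forall>e\<in>E. e \<subseteq> V) \<and> (\<forall>e\<in>E. \<forall>e'\<in>E. e \<subseteq> e' \<longrightarrow> e = e')"

definition vertex_cover :: "'a set \<Rightarrow> 'a set set \<Rightarrow> 'a set \<Rightarrow> bool" where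
  "vertex_cover V E W \<longleftrightarrow> W \<subseteq> V \<and> (\<forall>e\<in>E. W \<inter> e \<noteq> {})"

definition minimal_vertex_cover :: "'a set \<Rightarrow> 'a set set \<Rightarrow> 'a set \<Rightarrow> bool" where
  "minimal_vertex_cover V E W \<longleftrightarrow> vertex_cover V E W \<and> (\<forall>W'. W' \<subset> W \<longrightarrow> \<not> vertex_cover V E W')"

text \<open>
  A polynomial is a finitely supported map from exponent vectors to coefficients. The type
  allows every element of \<open>'x\<close> as a variable; the polynomial ring over a set \<open>V\<close> of variables
  is its subring of polynomials in which only variables from \<open>V\<close> occur, and ideals are
  taken in that subring.
\<close>

type_synonym ('x, 'k) mpol = "('x \<Rightarrow>\<^sub>0 nat) \<Rightarrow>\<^sub>0 'k"

definition const :: "'k::field \<Rightarrow> ('x, 'k) mpol" where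
  "const c = Poly_Mapping.single 0 c"

definition var :: "'x \<Rightarrow> ('x, 'k::field) mpol" where
  "var x = Poly_Mapping.single (Poly_Mapping.single x 1) 1"

definition mpol_ring :: "'x set \<Rightarrow> ('x, 'k::field) mpol ring" where
  "mpol_ring V =
     \<lparr>carrier = {p. \<forall>m\<in>Poly_Mapping.keys p. Poly_Mapping.keys m \<subseteq> V},
      monoid.mult = (*), one = 1, zero = 0, add = (+)\<rparr>"

lemma cring_mpol_ring: "cring (mpol_ring V :: ('x, 'k::field) mpol ring)"
proof (rule cringI)
  have add: "p + q \<in> carrier (mpol_ring V)"
    if "p \<in> carrier (mpol_ring V)" "q \<in> carrier (mpol_ring V)" for p q :: "('x, 'k) mpol"
    using that Poly_Mapping.keys_add[of p q] by (auto simp: mpol_ring_def)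
  have mult: "p * q \<in> carrier (mpol_ring V)"
    if p: "p \<in> carrier (mpol_ring V)" and q: "q \<in> carrier (mpol_ring V)" for p q :: "('x, 'k) mpol"
  proof -
    have "Poly_Mapping.keys m \<subseteq> V" if m: "m \<in> Poly_Mapping.keys (p * q)" for m
    proof -
      obtain a b where ab: "m = a + b" "a \<in> Poly_Mapping.keys p" "b \<in> Poly_Mapping.keys q"
        using m keys_mult[of p q] by blast
      then show ?thesis
        using p q Poly_Mapping.keys_add[of a b] by (force simp: mpol_ring_def)
    qed
    then show ?thesis by (simp add: mpol_ring_def)
  qed
  show "abelian_group (mpol_ring V :: ('x, 'k) mpol ring)"
  proof (rule abelian_groupI)
    fix p q r :: "('x, 'k) mpol"
    assume p: "p \<in> carrier (mpol_ring V)"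
    show "p \<oplus>\<^bsub>mpol_ring V\<^esub> q \<in> carrier (mpol_ring V)" if "q \<in> carrier (mpol_ring V)"
      using add[OF p that] by (simp add: mpol_ring_def)
    show "p \<oplus>\<^bsub>mpol_ring V\<^esub> q \<oplus>\<^bsub>mpol_ring V\<^esub> r
        = p \<oplus>\<^bsub>mpol_ring V\<^esub> (q \<oplus>\<^bsub>mpol_ring V\<^esub> r)"
      by (simp add: mpol_ring_def add.assoc)
    show "p \<oplus>\<^bsub>mpol_ring V\<^esub> q = q \<oplus>\<^bsub>mpol_ring V\<^esub> p"
      by (simp add: mpol_ring_def add.commute)
    show "\<exists>q\<in>carrier (mpol_ring V). q \<oplus>\<^bsub>mpol_ring V\<^esub> p = \<zero>\<^bsub>mpol_ring V\<^esub>"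
      using p by (intro bexI[of _ "- p"]) (simp_all add: mpol_ring_def)
  qed (simp_all add: mpol_ring_def)
  show "comm_monoid (mpol_ring V :: ('x, 'k) mpol ring)"
  proof (rule comm_monoidI)
    fix p q :: "('x, 'k) mpol"
    assume "p \<in> carrier (mpol_ring V)" "q \<in> carrier (mpol_ring V)"
    from mult[OF this] show "p \<otimes>\<^bsub>mpol_ring V\<^esub> q \<in> carrier (mpol_ring V)"
      by (simp add: mpol_ring_def)
  qed (simp_all add: mpol_ring_def mult.assoc mult.commute)
qed (simp add: mpol_ring_def distrib_right)

definition ideal_radical :: "('a, 'b) ring_scheme \<Rightarrow> 'a set \<Rightarrow> 'a set" where
  "ideal_radical R I = {a \<in> carrier R. \<exists>n::nat. n > 0 \<and> a [^]\<^bsub>R\<^esub> n \<in> I}"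

definition edge_ideal :: "'x set \<Rightarrow> 'x set set \<Rightarrow> ('x, 'k::field) mpol set" where
  "edge_ideal V E = Idl\<^bsub>mpol_ring V\<^esub> ((\<lambda>e. \<Prod>x\<in>e. var x) ` E)"

text \<open>The jet variable $x_i$ is the pair \<open>(x, i)\<close>.\<close>

definition jet_vars :: "nat \<Rightarrow> 'x set \<Rightarrow> ('x \<times> nat) set" where
  "jet_vars s X = X \<times> {0..s}"

text \<open>
  The homomorphism $\phi_s$, given by substituting $\sum_{j \le s} x_j t^j$ for each variable $x$.
  An element of the quotient modulo $t^{s+1}$ is represented by its unique representative of
  degree at most $s$ in $t$, hence the cutoff.
\<close>

definition jet_hom :: "nat \<Rightarrow> ('x, 'k::field) mpol \<Rightarrow> ('x \<times> nat, 'k) mpol poly" where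
  "jet_hom s p = poly_cutoff (Suc s)
     (\<Sum>m\<in>Poly_Mapping.keys p. [:const (Poly_Mapping.lookup p m):] *
        (\<Prod>x\<in>Poly_Mapping.keys m. (\<Sum>j=0..s. monom (var (x, j)) j) ^ Poly_Mapping.lookup m x))"

text \<open>
  The ideal of jets is defined through a finite generating set of \<open>I\<close>; since $\phi_s$ is
  a ring homomorphism, it does not depend on which one is chosen.
\<close>

definition jets_ideal :: "nat \<Rightarrow> 'x set \<Rightarrow> ('x, 'k::field) mpol set \<Rightarrow> ('x \<times> nat, 'k) mpol set" where
  "jets_ideal s X I =
     (let F = (SOME F. finite F \<and> F \<subseteq> carrier (mpol_ring X) \<and> I = Idl\<^bsub>mpol_ring X\<^esub> F)
      in Idl\<^bsub>mpol_ring (jet_vars s X)\<^esub> {coeff (jet_hom s f) j | f j. f \<in> F \<and> j \<le> s})"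

text \<open>
  The edge set of the clutter of \<open>s\<close>-jets of the clutter \<open>(X, E)\<close>, whose vertex set is
  \<open>jet_vars s X\<close>. The type argument is the coefficient field of the ideals involved.
\<close>

definition jets_edges :: "'k::field itself \<Rightarrow> nat \<Rightarrow> 'x set \<Rightarrow> 'x set set \<Rightarrow> ('x \<times> nat) set set" where
  "jets_edges _ s X E =
     (THE D. clutter (jet_vars s X) D \<and>
        (edge_ideal (jet_vars s X) D :: ('x \<times> nat, 'k) mpol set) =
          ideal_radical (mpol_ring (jet_vars s X)) (jets_ideal s X (edge_ideal X E)))"

end

theory Submission
  imports Defs
begin

text \<open>
  By the theorem of Goward and Smith, the edges of the jet clutter are the sets
  \<open>{(x, h x) | x \<in> e}\<close> with \<open>e\<close> an edge and \<open>h\<close> of weight at most \<open>s\<close>. If \<open>W\<close> is a minimal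
  cover containing \<open>(x, i)\<close>, some jet edge meets \<open>W\<close> only in \<open>(x, i)\<close>; lowering the value of
  \<open>h\<close> at \<open>x\<close> from \<open>i\<close> to \<open>j\<close> gives another jet edge, which can meet \<open>W\<close> only in \<open>(x, j)\<close>.
\<close>

abbreviation keys :: "('a \<Rightarrow>\<^sub>0 'b::zero) \<Rightarrow> 'a set" where
  "keys \<equiv> Poly_Mapping.keys"

abbreviation lookup :: "('a \<Rightarrow>\<^sub>0 'b::zero) \<Rightarrow> 'a \<Rightarrow> 'b" where
  "lookup \<equiv> Poly_Mapping.lookup"

subsection \<open>Ideals of a polynomial ring\<close>

lemma mpol_ring_simps [simp]:
  "p \<otimes>\<^bsub>mpol_ring V\<^esub> q = p * q" "p \<oplus>\<^bsub>mpol_ring V\<^esub> q = p + q"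
  "\<one>\<^bsub>mpol_ring V\<^esub> = 1" "\<zero>\<^bsub>mpol_ring V\<^esub> = 0"
  by (simp_all add: mpol_ring_def)

lemma mem_carrier_mpol_ring:
  "p \<in> carrier (mpol_ring V) \<longleftrightarrow> (\<forall>m\<in>keys p. keys m \<subseteq> V)"
  by (simp add: mpol_ring_def)

lemma pow_mpol_ring [simp]: "p [^]\<^bsub>mpol_ring V\<^esub> (n::nat) = p ^ n"
  by (induction n) (simp_all add: nat_pow_def mult.commute)

lemma ring_mpol_ring: "ring (mpol_ring V :: ('x, 'k::field) mpol ring)"
  using cring_mpol_ring cring.axioms(1) by blast

lemma zero_mem_mpol_ring [simp]: "0 \<in> carrier (mpol_ring V)"
  and one_mem_mpol_ring [simp]: "1 \<in> carrier (mpol_ring V)"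
  by (simp_all add: mem_carrier_mpol_ring)

lemma add_mem_mpol_ring:
  fixes p q :: "('x, 'k::field) mpol"
  assumes "p \<in> carrier (mpol_ring V)" "q \<in> carrier (mpol_ring V)"
  shows "p + q \<in> carrier (mpol_ring V)"
  using ring.ring_simprules(1)[OF ring_mpol_ring assms] by simp

lemma mult_mem_mpol_ring:
  fixes p q :: "('x, 'k::field) mpol"
  assumes "p \<in> carrier (mpol_ring V)" "q \<in> carrier (mpol_ring V)"
  shows "p * q \<in> carrier (mpol_ring V)"
  using ring.ring_simprules(5)[OF ring_mpol_ring assms] by simp

lemma uminus_mem_mpol_ring: "p \<in> carrier (mpol_ring V) \<Longrightarrow> - p \<in> carrier (mpol_ring V)"
  by (simp add: mem_carrier_mpol_ring)

lemma sum_mem_mpol_ring: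
  "(\<And>i. i \<in> A \<Longrightarrow> f i \<in> carrier (mpol_ring V)) \<Longrightarrow> sum f A \<in> carrier (mpol_ring V)"
  by (induction A rule: infinite_finite_induct) (auto intro: add_mem_mpol_ring)

lemma prod_mem_mpol_ring:
  "(\<And>i. i \<in> A \<Longrightarrow> f i \<in> carrier (mpol_ring V)) \<Longrightarrow> prod f A \<in> carrier (mpol_ring V)"
  by (induction A rule: infinite_finite_induct) (auto intro: mult_mem_mpol_ring)

lemma power_mem_mpol_ring: "p \<in> carrier (mpol_ring V) \<Longrightarrow> p ^ n \<in> carrier (mpol_ring V)"
  by (induction n) (auto intro: mult_mem_mpol_ring)

lemma const_mem_mpol_ring: "const c \<in> carrier (mpol_ring V)"
  by (simp add: mem_carrier_mpol_ring const_def)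

lemma of_nat_mem_mpol_ring: "of_nat n \<in> carrier (mpol_ring V)"
  by (induction n) (auto intro: add_mem_mpol_ring)

lemma var_mem_mpol_ring: "x \<in> V \<Longrightarrow> var x \<in> carrier (mpol_ring V)"
  by (simp add: mem_carrier_mpol_ring var_def)

lemma mpol_ideal_subset: "ideal I (mpol_ring V) \<Longrightarrow> I \<subseteq> carrier (mpol_ring V)"
  by (simp add: additive_subgroup.a_subset ideal.axioms(1))

lemma mpol_ideal_zero: "ideal I (mpol_ring V) \<Longrightarrow> 0 \<in> I"
  using additive_subgroup.zero_closed[OF ideal.axioms(1)] by fastforce

lemma mpol_ideal_add: "ideal I (mpol_ring V) \<Longrightarrow> p \<in> I \<Longrightarrow> q \<in> I \<Longrightarrow> p + q \<in> I"
  using additive_subgroup.a_closed[OF ideal.axioms(1)] by fastforce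

lemma mpol_ideal_mult:
  "ideal I (mpol_ring V) \<Longrightarrow> p \<in> I \<Longrightarrow> q \<in> carrier (mpol_ring V) \<Longrightarrow> q * p \<in> I"
  using ideal.I_l_closed by fastforce

lemma mpol_ideal_uminus:
  assumes "ideal I (mpol_ring V)" "p \<in> I"
  shows "- p \<in> I"
  using mpol_ideal_mult[OF assms, of "- 1"] by (simp add: uminus_mem_mpol_ring)

lemma mpol_ideal_diff: "ideal I (mpol_ring V) \<Longrightarrow> p \<in> I \<Longrightarrow> q \<in> I \<Longrightarrow> p - q \<in> I"
  using mpol_ideal_add[of I V p "- q"] mpol_ideal_uminus by auto

lemma mpol_ideal_sum:
  "ideal I (mpol_ring V) \<Longrightarrow> (\<And>i. i \<in> A \<Longrightarrow> f i \<in> I) \<Longrightarrow> sum f A \<in> I"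
  by (induction A rule: infinite_finite_induct) (auto intro: mpol_ideal_add mpol_ideal_zero)

text \<open>Multiplication by the constant \<open>- 1\<close> supplies additive inverses, so
  negation does not appear among the closure conditions.\<close>

lemma mpol_idealI:
  fixes I :: "('x, 'k::field) mpol set"
  assumes sub: "I \<subseteq> carrier (mpol_ring V)" and zero: "0 \<in> I"
    and add: "\<And>p q. p \<in> I \<Longrightarrow> q \<in> I \<Longrightarrow> p + q \<in> I"
    and mult: "\<And>p q. p \<in> I \<Longrightarrow> q \<in> carrier (mpol_ring V) \<Longrightarrow> q * p \<in> I"
  shows "ideal I (mpol_ring V)"
proof (rule idealI[OF ring_mpol_ring])
  interpret R: ring "mpol_ring V :: ('x, 'k) mpol ring" by (rule ring_mpol_ring)
  have inv: "\<ominus>\<^bsub>mpol_ring V\<^esub> p = - p" if "p \<in> carrier (mpol_ring V)" for p :: "('x, 'k) mpol"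
    by (rule R.minus_equality) (use that uminus_mem_mpol_ring in auto)
  show "subgroup I (add_monoid (mpol_ring V))"
  proof (rule R.add.subgroupI)
    fix p assume p: "p \<in> I"
    have "- p \<in> I" using mult[OF p, of "- 1"] by (simp add: uminus_mem_mpol_ring)
    then show "\<ominus>\<^bsub>mpol_ring V\<^esub> p \<in> I" using inv p sub by auto
  qed (use sub zero add in auto)
qed (use mult in \<open>auto simp: mult.commute\<close>)

lemma mpol_genideal:
  fixes S :: "('x, 'k::field) mpol set"
  assumes "S \<subseteq> carrier (mpol_ring V)"
  shows "ideal (Idl\<^bsub>mpol_ring V\<^esub> S) (mpol_ring V)" and "S \<subseteq> Idl\<^bsub>mpol_ring V\<^esub> S"
  using ring.genideal_ideal[OF ring_mpol_ring assms] ring.genideal_self[OF ring_mpol_ring assms]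
  by auto

lemma mpol_genideal_least:
  fixes S :: "('x, 'k::field) mpol set"
  assumes "ideal I (mpol_ring V)" "S \<subseteq> I"
  shows "Idl\<^bsub>mpol_ring V\<^esub> S \<subseteq> I"
  using ring.genideal_minimal[OF ring_mpol_ring assms] .

section \<open>Radicals of ideals\<close>

lemma mem_mpol_radical:
  "p \<in> ideal_radical (mpol_ring V) I \<longleftrightarrow>
     p \<in> carrier (mpol_ring V) \<and> (\<exists>n>0. p ^ n \<in> I)"
  by (auto simp: ideal_radical_def)

text \<open>In the binomial expansion of \<open>(p + q) ^ (m + n)\<close> every term has
  \<open>p ^ m\<close> or \<open>q ^ n\<close> as a factor, so it lies in \<open>I\<close>.\<close>

lemma ideal_mpol_radical:
  assumes I: "ideal I (mpol_ring V :: ('x, 'k::field) mpol ring)"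
  shows "ideal (ideal_radical (mpol_ring V) I) (mpol_ring V)"
proof (rule mpol_idealI)
  show "ideal_radical (mpol_ring V) I \<subseteq> carrier (mpol_ring V)"
    by (auto simp: mem_mpol_radical)
  show "0 \<in> ideal_radical (mpol_ring V) I"
    using mpol_ideal_zero[OF I] by (auto simp: mem_mpol_radical intro: exI[of _ 1])
next
  fix p q assume "p \<in> ideal_radical (mpol_ring V) I" and "q \<in> ideal_radical (mpol_ring V) I"
  then obtain m n where p: "p \<in> carrier (mpol_ring V)" "p ^ m \<in> I" "m > 0"
    and q: "q \<in> carrier (mpol_ring V)" "q ^ n \<in> I" "n > 0"
    by (auto simp: mem_mpol_radical)
  have "of_nat (m + n choose k) * p ^ k * q ^ (m + n - k) \<in> I" if "k \<le> m + n" for k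
  proof (cases "k \<ge> m")
    case True
    have "(of_nat (m + n choose k) * p ^ (k - m) * q ^ (m + n - k)) * p ^ m \<in> I"
      using p q by (intro mpol_ideal_mult[OF I] mult_mem_mpol_ring power_mem_mpol_ring of_nat_mem_mpol_ring)
    moreover have "p ^ k = p ^ (k - m) * p ^ m"
      using True by (simp flip: power_add)
    ultimately show ?thesis by (simp add: ac_simps)
  next
    case False
    then have *: "m + n - k = (m - k) + n" by simp
    have "(of_nat (m + n choose k) * p ^ k * q ^ (m - k)) * q ^ n \<in> I"
      using p q by (intro mpol_ideal_mult[OF I] mult_mem_mpol_ring power_mem_mpol_ring of_nat_mem_mpol_ring)
    then show ?thesis unfolding * power_add by (simp add: ac_simps)
  qed
  then have "(p + q) ^ (m + n) \<in> I"
    unfolding binomial_ring by (intro mpol_ideal_sum[OF I]) auto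
  then show "p + q \<in> ideal_radical (mpol_ring V) I"
    using p q by (auto simp: mem_mpol_radical add_mem_mpol_ring intro!: exI[of _ "m + n"])
next
  fix p q :: "('x, 'k) mpol"
  assume "p \<in> ideal_radical (mpol_ring V) I" and q: "q \<in> carrier (mpol_ring V)"
  then obtain n where p: "p \<in> carrier (mpol_ring V)" "p ^ n \<in> I" "n > 0"
    by (auto simp: mem_mpol_radical)
  have "(q * p) ^ n \<in> I"
    unfolding power_mult_distrib using p q by (intro mpol_ideal_mult[OF I] power_mem_mpol_ring)
  then show "q * p \<in> ideal_radical (mpol_ring V) I"
    using p q by (auto simp: mem_mpol_radical mult_mem_mpol_ring)
qed

text \<open>Lets the induction in \<open>jet_monomial_mem_radical\<close> stop at the square of a
  monomial.\<close>

lemma mpol_radical_power2: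
  assumes "p \<in> carrier (mpol_ring V)" "p * p \<in> ideal_radical (mpol_ring V) I"
  shows "p \<in> ideal_radical (mpol_ring V) I"
proof -
  obtain n where "n > 0" "(p * p) ^ n \<in> I"
    using assms by (auto simp: mem_mpol_radical)
  then have "p ^ (n + n) \<in> I" "n + n > 0" by (simp_all add: power_add power_mult_distrib)
  then show ?thesis using assms(1) unfolding mem_mpol_radical by blast
qed

subsection \<open>Squarefree monomial ideals\<close>

lemma mpol_sum_single:
  "p = (\<Sum>m\<in>keys p. Poly_Mapping.single m (lookup p m))"
  by (rule poly_mapping_eqI) (simp add: lookup_sum lookup_single when_def in_keys_iff)

text \<open>The 0-1 exponent vector of the squarefree monomial supported on a finite
  \<open>e\<close>.\<close>

definition set_exp :: "'x set \<Rightarrow> 'x \<Rightarrow>\<^sub>0 nat" where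
  "set_exp e = (\<Sum>x\<in>e. Poly_Mapping.single x 1)"

lemma lookup_set_exp: "finite e \<Longrightarrow> lookup (set_exp e) x = (if x \<in> e then 1 else 0)"
  by (simp add: set_exp_def lookup_sum lookup_single when_def)

lemma keys_set_exp: "finite e \<Longrightarrow> keys (set_exp e) = e"
  by (auto simp: in_keys_iff lookup_set_exp split: if_splits)

lemma prod_var: "finite e \<Longrightarrow> (\<Prod>x\<in>e. var x) = Poly_Mapping.single (set_exp e) 1"
  unfolding set_exp_def by (induction e rule: finite_induct) (simp_all add: var_def mult_single)

lemma keys_prod_var:
  "finite e \<Longrightarrow> keys (\<Prod>x\<in>e. var x :: ('x, 'k::field) mpol) = {set_exp e}"
  by (simp add: prod_var)

lemma prod_var_mem_mpol_ring: "e \<subseteq> V \<Longrightarrow> (\<Prod>x\<in>e. var x) \<in> carrier (mpol_ring V)"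
  by (intro prod_mem_mpol_ring var_mem_mpol_ring) auto

text \<open>Exponents are natural numbers, so multiplication only enlarges supports, and an edge
  inside a support stays there.\<close>

lemma ideal_monomial:
  "ideal {p \<in> carrier (mpol_ring V :: ('x, 'k::field) mpol ring). \<forall>m\<in>keys p. \<exists>e\<in>D. e \<subseteq> keys m}
     (mpol_ring V)" (is "ideal ?M _")
proof (rule mpol_idealI)
  fix p q assume "p \<in> ?M" "q \<in> ?M"
  then show "p + q \<in> ?M" using keys_add[of p q] by (fastforce intro: add_mem_mpol_ring)
next
  fix p q :: "('x, 'k) mpol" assume p: "p \<in> ?M" and q: "q \<in> carrier (mpol_ring V)"
  have "\<exists>e\<in>D. e \<subseteq> keys m" if "m \<in> keys (q * p)" for m
  proof -
    obtain a b where "m = a + b" "b \<in> keys p"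
      using \<open>m \<in> keys (q * p)\<close> keys_mult[of q p] by blast
    moreover have "keys b \<subseteq> keys (a + b)" by (auto simp: in_keys_iff lookup_add)
    ultimately show ?thesis using p by blast
  qed
  then show "q * p \<in> ?M" using p q by (auto intro: mult_mem_mpol_ring)
qed auto

text \<open>Each generator has a single exponent, with an edge as support; conversely, a term whose
  support contains an edge is a multiple of the monomial of that edge. Finiteness of
  \<open>V\<close> makes the edges finite, whereas a product over an infinite set would be
  1.\<close>

lemma edge_ideal_eq:
  assumes "finite V" "\<forall>e\<in>D. e \<subseteq> V"
  shows "(edge_ideal V D :: ('x, 'k::field) mpol set) =
    {p \<in> carrier (mpol_ring V). \<forall>m\<in>keys p. \<exists>e\<in>D. e \<subseteq> keys m}" (is "_ = ?M")
proof
  let ?G = "(\<lambda>e. \<Prod>x\<in>e. var x :: ('x, 'k) mpol) ` D"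
  have fin: "finite e" if "e \<in> D" for e using that assms finite_subset by blast
  have G: "?G \<subseteq> carrier (mpol_ring V)" using assms(2) by (auto intro: prod_var_mem_mpol_ring)
  show "edge_ideal V D \<subseteq> ?M"
    unfolding edge_ideal_def
  proof (rule mpol_genideal_least[OF ideal_monomial], rule subsetI)
    fix p assume p: "p \<in> ?G"
    then obtain e where "e \<in> D" "p = (\<Prod>x\<in>e. var x)" by blast
    then have "keys p = {set_exp e}" "keys (set_exp e) = e"
      using fin by (simp_all add: keys_prod_var keys_set_exp)
    then show "p \<in> ?M" using p G \<open>e \<in> D\<close> by auto
  qed
  note I = mpol_genideal[OF G, folded edge_ideal_def]
  show "?M \<subseteq> edge_ideal V D"
  proof
    fix p assume p: "p \<in> ?M"
    have "Poly_Mapping.single m (lookup p m) \<in> edge_ideal V D" if m_p: "m \<in> keys p" for m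
    proof -
      obtain e where e: "e \<in> D" "e \<subseteq> keys m" using p m_p by blast
      \<comment> \<open>The exponent of the quotient by the edge monomial; truncated subtraction is
        exact because \<open>e\<close> lies in the support of \<open>m\<close>.\<close>
      define m' where "m' = m - set_exp e"
      have m: "m = m' + set_exp e"
        unfolding m'_def using e fin
        by (intro poly_mapping_eqI) (auto simp: lookup_add lookup_minus lookup_set_exp in_keys_iff)
      have "keys m' \<subseteq> keys m" by (auto simp: m in_keys_iff lookup_add)
      then have "Poly_Mapping.single m' (lookup p m) \<in> carrier (mpol_ring V)"
        using p m_p by (auto simp: mem_carrier_mpol_ring)
      then have "Poly_Mapping.single m' (lookup p m) * (\<Prod>x\<in>e. var x) \<in> edge_ideal V D"
        using e(1) I by (intro mpol_ideal_mult[OF I(1)]) auto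
      moreover have "Poly_Mapping.single m' (lookup p m) * (\<Prod>x\<in>e. var x)
          = Poly_Mapping.single m (lookup p m)"
        using e fin by (simp add: prod_var mult_single flip: m)
      ultimately show ?thesis by simp
    qed
    then show "p \<in> edge_ideal V D"
      by (subst mpol_sum_single) (intro mpol_ideal_sum[OF I(1)])
  qed
qed

text \<open>Every edge of one clutter contains an edge of the other, which in turn contains an edge
  of the first; as edges of a clutter are incomparable, all three coincide. This gives the
  uniqueness behind \<open>THE\<close> in \<open>jets_edges\<close>.\<close>

lemma clutter_edge_ideal_inject:
  assumes "finite V" "clutter V D" "clutter V D'"
    and eq: "(edge_ideal V D :: ('x, 'k::field) mpol set) = edge_ideal V D'"
  shows "D = D'"
proof -
  \<comment> \<open>The monomial of \<open>e\<close> lies in both ideals, and the membership test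
    for \<open>B\<close>, applied to its only exponent, yields \<open>e'\<close>.\<close>
  have *: "\<exists>e'\<in>B. e' \<subseteq> e"
    if "clutter V A" "clutter V B" "e \<in> A"
      "(edge_ideal V A :: ('x, 'k) mpol set) = edge_ideal V B" for A B e
  proof -
    have sub: "\<forall>e\<in>A. e \<subseteq> V" "\<forall>e\<in>B. e \<subseteq> V" using that by (auto simp: clutter_def)
    have e: "e \<subseteq> V" "finite e"
      using sub that(3) finite_subset[OF _ assms(1), of e] by auto
    have "(\<Prod>x\<in>e. var x :: ('x, 'k) mpol) \<in> edge_ideal V A"
      using that(3) e unfolding edge_ideal_eq[OF assms(1) sub(1)]
      by (auto simp: keys_prod_var keys_set_exp intro: prod_var_mem_mpol_ring)
    then show ?thesis
      unfolding that(4) edge_ideal_eq[OF assms(1) sub(2)] using e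
      by (auto simp: keys_prod_var keys_set_exp)
  qed
  have "A \<subseteq> B"
    if A: "clutter V A" and B: "clutter V B"
      and AB: "(edge_ideal V A :: ('x, 'k) mpol set) = edge_ideal V B" for A B
  proof
    fix e assume e: "e \<in> A"
    obtain e' where e': "e' \<in> B" "e' \<subseteq> e" using *[OF A B e AB] by blast
    obtain e'' where e'': "e'' \<in> A" "e'' \<subseteq> e'"
      using *[OF B A e'(1) AB[symmetric]] by blast
    have "e'' = e" using A e e' e'' unfolding clutter_def by (meson order_trans)
    then show "e \<in> B" using e' e'' by auto
  qed
  from this[OF assms(2,3) eq] this[OF assms(3,2) eq[symmetric]] show ?thesis by blast
qed

text \<open>
  By the parallelogram law. An exponent of maximal Euclidean norm thus takes the role of a leading
  monomial, and no order on the variables is needed.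
\<close>
lemma exponent_midpoint:
  fixes a b m :: "'x \<Rightarrow>\<^sub>0 nat"
  assumes U: "finite U" "keys a \<subseteq> U" "keys b \<subseteq> U" and eq: "a + b = m + m"
    and a: "(\<Sum>x\<in>U. (lookup a x)\<^sup>2) \<le> (\<Sum>x\<in>U. (lookup m x)\<^sup>2)"
    and b: "(\<Sum>x\<in>U. (lookup b x)\<^sup>2) \<le> (\<Sum>x\<in>U. (lookup m x)\<^sup>2)"
  shows "a = m" "b = m"
proof -
  \<comment> \<open>Passing to integers keeps the differences of exponents from being
    truncated.\<close>
  let ?a = "\<lambda>x. int (lookup a x)" and ?b = "\<lambda>x. int (lookup b x)" and ?m = "\<lambda>x. int (lookup m x)"
  have eq': "?a x + ?b x = 2 * ?m x" for x
    using arg_cong[OF eq, of "\<lambda>c. lookup c x"] by (simp add: lookup_add flip: of_nat_add)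
  have a': "(\<Sum>x\<in>U. (?a x)\<^sup>2) \<le> (\<Sum>x\<in>U. (?m x)\<^sup>2)" and b': "(\<Sum>x\<in>U. (?b x)\<^sup>2) \<le> (\<Sum>x\<in>U. (?m x)\<^sup>2)"
    using a b by (simp_all flip: of_nat_power of_nat_sum)
  have "(?a x - ?b x)\<^sup>2 = 2 * (?a x)\<^sup>2 + 2 * (?b x)\<^sup>2 - 4 * (?m x)\<^sup>2" for x
  proof -
    have "4 * (?m x)\<^sup>2 = (?a x + ?b x)\<^sup>2" by (simp add: eq' power_mult_distrib)
    then show ?thesis by (simp add: power2_eq_square algebra_simps)
  qed
  then have "(\<Sum>x\<in>U. (?a x - ?b x)\<^sup>2) =
      2 * (\<Sum>x\<in>U. (?a x)\<^sup>2) + 2 * (\<Sum>x\<in>U. (?b x)\<^sup>2) - 4 * (\<Sum>x\<in>U. (?m x)\<^sup>2)"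
    by (simp add: sum.distrib sum_subtractf sum_distrib_left)
  then have "(\<Sum>x\<in>U. (?a x - ?b x)\<^sup>2) \<le> 0" using a' b' by linarith
  then have "(\<Sum>x\<in>U. (?a x - ?b x)\<^sup>2) = 0" by (simp add: order_antisym sum_nonneg)
  then have "\<forall>x\<in>U. (?a x - ?b x)\<^sup>2 = 0" using U(1) by (simp add: sum_nonneg_eq_0_iff)
  moreover have "lookup a x = lookup b x" if "x \<notin> U" for x
    using that U in_keys_iff[of x a] in_keys_iff[of x b] by auto
  ultimately have ab: "lookup a x = lookup b x" for x by (cases "x \<in> U") auto
  then show "a = m" using eq'
    by (intro poly_mapping_eqI) (metis (full_types) ab mult_2 mult_left_cancel of_nat_eq_iff zero_neq_numeral)
  then show "b = m" using ab by (auto intro: poly_mapping_eqI)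
qed

text \<open>It suffices to treat squares. If \<open>p\<close> is outside the ideal, choose
  \<open>m\<close> of maximal norm among its exponents whose support contains no edge. The term of
  \<open>p * p\<close> at \<open>m + m\<close> comes from \<open>m\<close> alone, so it does not
  cancel, and its support is still that of \<open>m\<close>.\<close>

lemma radical_edge_ideal:
  assumes V: "finite V" and D: "\<forall>e\<in>D. e \<subseteq> V"
  shows "ideal_radical (mpol_ring V) (edge_ideal V D :: ('x, 'k::field) mpol set) \<subseteq> edge_ideal V D"
proof
  let ?I = "edge_ideal V D :: ('x, 'k) mpol set"
  note mem = edge_ideal_eq[OF V D, where ?'k = 'k]
  have ideal: "ideal ?I (mpol_ring V)" unfolding mem by (rule ideal_monomial)
  have sq: "p \<in> ?I" if p: "p \<in> carrier (mpol_ring V)" and pp: "p * p \<in> ?I" for p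
  proof (rule ccontr)
    assume "p \<notin> ?I"
    define K where "K = {m \<in> keys p. \<not> (\<exists>e\<in>D. e \<subseteq> keys m)}"
    define N where "N m = (\<Sum>x\<in>V. (lookup m x)\<^sup>2)" for m :: "'x \<Rightarrow>\<^sub>0 nat"
    have "finite K" "K \<noteq> {}" using \<open>p \<notin> ?I\<close> p by (auto simp: K_def mem)
    then have "Max (N ` K) \<in> N ` K" by simp
    then obtain m where m: "m \<in> K" "N m = Max (N ` K)" by auto
    have max: "N a \<le> N m" if "a \<in> K" for a
      using that \<open>finite K\<close> by (simp add: m(2))
    \<comment> \<open>Both supports lie in that of \<open>m\<close>, so neither contains an edge;
      thus \<open>a\<close> and \<open>b\<close> belong to \<open>K\<close>, and maximality of
      \<open>m\<close> makes \<open>exponent_midpoint\<close> applicable.\<close>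
    have only: "a = m \<and> b = m" if "a \<in> keys p" "b \<in> keys p" "a + b = m + m" for a b
    proof -
      have "keys a \<union> keys b \<subseteq> keys m"
      proof
        fix x assume "x \<in> keys a \<union> keys b"
        moreover have "lookup a x + lookup b x = lookup m x + lookup m x"
          using arg_cong[OF that(3), of "\<lambda>c. lookup c x"] by (simp add: lookup_add)
        ultimately show "x \<in> keys m" by (auto simp: in_keys_iff)
      qed
      then have "a \<in> K" "b \<in> K" using m(1) that unfolding K_def by blast+
      then have "N a \<le> N m" "N b \<le> N m" using max by auto
      moreover have "keys a \<subseteq> V" "keys b \<subseteq> V" using p that by (auto simp: mem_carrier_mpol_ring)
      ultimately show ?thesis
        using exponent_midpoint[OF V _ _ that(3)] by (simp add: N_def)
    qed
    define c where "c = lookup p m"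
    have "c \<noteq> 0" using m by (simp add: c_def K_def in_keys_iff)
    \<comment> \<open>With the term at \<open>m\<close> split off, no product of \<open>r\<close>
      with a polynomial supported on exponents of \<open>p\<close> reaches \<open>m + m\<close>, so
      only \<open>c * c\<close> remains there.\<close>
    define r where "r = p - Poly_Mapping.single m c"
    have m_r: "m \<notin> keys r" by (simp add: r_def in_keys_iff lookup_minus c_def)
    have r_p: "keys r \<subseteq> keys p"
      using m(1) by (auto simp: r_def K_def in_keys_iff lookup_minus lookup_single when_def split: if_splits)
    have p_eq: "p = Poly_Mapping.single m c + r" by (simp add: r_def)
    have "m + m \<notin> keys (q * r)" if "keys q \<subseteq> keys p" for q
    proof
      assume "m + m \<in> keys (q * r)"
      then obtain a b where "m + m = a + b" "a \<in> keys q" "b \<in> keys r"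
        using keys_mult[of q r] by blast
      then show False using only[of a b] that r_p m_r by auto
    qed
    moreover have "keys (Poly_Mapping.single m c) \<subseteq> keys p" using m(1) by (simp add: K_def)
    ultimately have *: "lookup (p * r) (m + m) = 0" "lookup (Poly_Mapping.single m c * r) (m + m) = 0"
      by (simp_all add: in_keys_iff)
    have "p * p = p * Poly_Mapping.single m c + p * r"
      by (subst (2) p_eq) (rule distrib_left)
    moreover have "p * Poly_Mapping.single m c = Poly_Mapping.single (m + m) (c * c) + Poly_Mapping.single m c * r"
      by (subst p_eq, subst distrib_right) (simp add: mult_single mult.commute)
    ultimately have "lookup (p * p) (m + m) = c * c" by (simp add: lookup_add *)
    then have "m + m \<in> keys (p * p)" using \<open>c \<noteq> 0\<close> by (simp add: in_keys_iff)
    moreover have "keys (m + m) = keys m" by (auto simp: in_keys_iff lookup_add)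
    ultimately show False using pp m by (auto simp: mem K_def)
  qed
  fix p assume "p \<in> ideal_radical (mpol_ring V) ?I"
  then obtain n where p: "p \<in> carrier (mpol_ring V)" and n: "n > 0" "p ^ n \<in> ?I"
    by (auto simp: mem_mpol_radical)
  from n show "p \<in> ?I"
  proof (induction n rule: less_induct)
    case (less n)
    show ?case
    proof (cases "n = 1")
      case True
      then show ?thesis using less by simp
    next
      case False
      \<comment> \<open>Half of \<open>n\<close>, rounded up: smaller than \<open>n\<close> because
        \<open>n > 1\<close>, while \<open>p ^ (k + k)\<close> is still a multiple of
        \<open>p ^ n\<close>.\<close>
      define k where "k = (n + 1) div 2"
      have k: "0 < k" "k < n" "k + k = n + (k + k - n)" using False less.prems by (auto simp: k_def)
      have "p ^ k * p ^ k = p ^ (k + k - n) * p ^ n"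
        unfolding power_add[symmetric] using k(3) by (simp add: add.commute)
      then have "p ^ k \<in> ?I"
        using sq[of "p ^ k"] p mpol_ideal_mult[OF ideal less.prems(2)] by (simp add: power_mem_mpol_ring)
      then show ?thesis using less.IH k by blast
    qed
  qed
qed

subsection \<open>The jet homomorphism\<close>

definition jet_monomial :: "nat \<Rightarrow> ('x \<Rightarrow>\<^sub>0 nat) \<Rightarrow> ('x \<times> nat, 'k::field) mpol poly" where
  "jet_monomial s m = (\<Prod>x\<in>keys m. (\<Sum>j=0..s. monom (var (x, j)) j) ^ lookup m x)"

text \<open>Before the cutoff the substitution is an honest ring homomorphism, while truncated
  representatives multiply only modulo a power of \<open>t\<close>. The coefficients up to
  \<open>s\<close> are the same.\<close>

definition jet_subst :: "nat \<Rightarrow> ('x, 'k::field) mpol \<Rightarrow> ('x \<times> nat, 'k) mpol poly" where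
  "jet_subst s p = (\<Sum>m\<in>keys p. [:const (lookup p m):] * jet_monomial s m)"

lemma coeff_jet_hom: "j \<le> s \<Longrightarrow> coeff (jet_hom s p) j = coeff (jet_subst s p) j"
  by (simp add: jet_hom_def coeff_poly_cutoff jet_subst_def jet_monomial_def)

text \<open>Variables outside the support contribute the factor 1, so two monomials can be compared
  over a common index set.\<close>

lemma jet_monomial_superset:
  assumes "finite A" "keys m \<subseteq> A"
  shows "jet_monomial s m = (\<Prod>x\<in>A. (\<Sum>j=0..s. monom (var (x, j)) j) ^ lookup m x)"
  unfolding jet_monomial_def
  by (rule prod.mono_neutral_left) (use assms in \<open>auto simp: in_keys_iff\<close>)

lemma jet_monomial_add: "jet_monomial s (a + b) = jet_monomial s a * jet_monomial s b"
proof -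
  have A: "finite (keys a \<union> keys b)" "keys (a + b) \<subseteq> keys a \<union> keys b"
    using keys_add[of a b] by auto
  show ?thesis
    unfolding jet_monomial_superset[OF A]
      jet_monomial_superset[OF A(1), of a, OF Un_upper1] jet_monomial_superset[OF A(1), of b, OF Un_upper2]
    by (simp add: lookup_add power_add prod.distrib)
qed

lemma jet_subst_superset:
  assumes "finite A" "keys p \<subseteq> A"
  shows "jet_subst s p = (\<Sum>m\<in>A. [:const (lookup p m):] * jet_monomial s m)"
  unfolding jet_subst_def
  by (rule sum.mono_neutral_left) (use assms in \<open>auto simp: in_keys_iff const_def\<close>)

lemma jet_subst_add:
  fixes p q :: "('x, 'k::field) mpol"
  shows "jet_subst s (p + q) = jet_subst s p + jet_subst s q"
proof -
  have A: "finite (keys p \<union> keys q)" "keys (p + q) \<subseteq> keys p \<union> keys q"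
    using keys_add[of p q] by auto
  have "[:const (a + b) :: ('x \<times> nat, 'k) mpol:] = [:const a:] + [:const b:]" for a b
    by (simp add: const_def single_add)
  then show ?thesis
    unfolding jet_subst_superset[OF A]
      jet_subst_superset[OF A(1), of p, OF Un_upper1] jet_subst_superset[OF A(1), of q, OF Un_upper2]
    by (simp only: lookup_add distrib_right sum.distrib)
qed

lemma jet_subst_0 [simp]: "jet_subst s 0 = 0"
  by (simp add: jet_subst_def)

lemma jet_subst_sum: "jet_subst s (sum f A) = (\<Sum>i\<in>A. jet_subst s (f i))"
  by (induction A rule: infinite_finite_induct) (simp_all add: jet_subst_add)

lemma jet_subst_single: "jet_subst s (Poly_Mapping.single m c) = [:const c:] * jet_monomial s m"
  by (cases "c = 0") (simp_all add: jet_subst_def const_def)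

text \<open>By bilinearity the claim reduces to single terms, where it rests on
  \<open>jet_monomial_add\<close>.\<close>

lemma jet_subst_mult:
  fixes p q :: "('x, 'k::field) mpol"
  shows "jet_subst s (p * q) = jet_subst s p * jet_subst s q"
proof -
  have "p * q = (\<Sum>a\<in>keys p. \<Sum>b\<in>keys q. Poly_Mapping.single (a + b) (lookup p a * lookup q b))"
    by (subst mpol_sum_single[of p], subst mpol_sum_single[of q])
      (simp add: sum_product mult_single)
  then have "jet_subst s (p * q)
      = (\<Sum>a\<in>keys p. \<Sum>b\<in>keys q. jet_subst s (Poly_Mapping.single (a + b) (lookup p a * lookup q b)))"
    by (simp add: jet_subst_sum)
  also have "\<dots> = (\<Sum>a\<in>keys p. \<Sum>b\<in>keys q.
      ([:const (lookup p a):] * jet_monomial s a) * ([:const (lookup q b):] * jet_monomial s b))"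
  proof (intro sum.cong refl)
    fix a b
    have "[:const (c * d) :: ('x \<times> nat, 'k) mpol:] = [:const c:] * [:const d:]" for c d
      by (simp add: const_def mult_single mult.commute)
    then show "jet_subst s (Poly_Mapping.single (a + b) (lookup p a * lookup q b)) =
        ([:const (lookup p a):] * jet_monomial s a) * ([:const (lookup q b):] * jet_monomial s b)"
      unfolding jet_subst_single jet_monomial_add by (simp only: ac_simps)
  qed
  also have "\<dots> = jet_subst s p * jet_subst s q"
    by (simp add: jet_subst_def sum_product)
  finally show ?thesis .
qed

lemma jet_subst_prod_var:
  assumes "finite e"
  shows "jet_subst s (\<Prod>x\<in>e. var x :: ('x, 'k::field) mpol) = (\<Prod>x\<in>e. \<Sum>j=0..s. monom (var (x, j)) j)"
proof -
  have "[:const 1:] = (1 :: ('x \<times> nat, 'k) mpol poly)" by (simp add: const_def one_pCons)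
  then show ?thesis
    using assms
    by (simp add: prod_var jet_subst_single jet_monomial_def keys_set_exp lookup_set_exp
        cong: prod.cong)
qed

text \<open>Expanding the product chooses an index \<open>h x\<close> from each factor, and the
  power of \<open>t\<close> records the total weight of \<open>h\<close>. Extensionality makes each
  choice occur exactly once.\<close>

lemma coeff_jet_subst_prod_var:
  assumes "finite e"
  shows "coeff (jet_subst s (\<Prod>x\<in>e. var x :: ('x, 'k::field) mpol)) k
    = (\<Sum>h | h \<in> e \<rightarrow>\<^sub>E {0..s} \<and> sum h e = k. \<Prod>x\<in>e. var (x, h x))"
proof -
  have *: "(\<Prod>x\<in>e. monom (var (x, h x)) (h x)) = monom (\<Prod>x\<in>e. var (x, h x) :: ('x \<times> nat, 'k) mpol) (sum h e)" for h :: "'x \<Rightarrow> nat"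
    using assms by (induction e rule: finite_induct) (simp_all add: mult_monom)
  have fin: "finite (e \<rightarrow>\<^sub>E {0..s})" using assms by (intro finite_PiE) auto
  show ?thesis
    using assms by (simp add: jet_subst_prod_var prod_sum_PiE * coeff_sum flip: sum.inter_filter[OF fin])
qed

lemma coeff_jet_subst_mem:
  fixes p :: "('x, 'k::field) mpol"
  assumes "p \<in> carrier (mpol_ring X)"
  shows "coeff (jet_subst s p) j \<in> carrier (mpol_ring (jet_vars s X))"
proof -
  \<comment> \<open>The polynomials in \<open>t\<close> over the subring, shown to be closed under
    the operations that build \<open>jet_subst\<close>.\<close>
  define P where "P = {f :: ('x \<times> nat, 'k) mpol poly. \<forall>j. coeff f j \<in> carrier (mpol_ring (jet_vars s X))}"
  have mult: "f * g \<in> P" if "f \<in> P" "g \<in> P" for f g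
    using that by (auto simp: P_def coeff_mult intro!: sum_mem_mpol_ring mult_mem_mpol_ring)
  have one: "1 \<in> P" by (auto simp: P_def coeff_1)
  have power: "f ^ n \<in> P" if "f \<in> P" for f n
    using that by (induction n) (auto simp: one mult)
  have prod: "prod f A \<in> P" if "\<And>i. i \<in> A \<Longrightarrow> f i \<in> P" for f and A :: "'x set"
    using that by (induction A rule: infinite_finite_induct) (auto simp: one mult)
  have sum: "sum f A \<in> P" if "\<And>i. i \<in> A \<Longrightarrow> f i \<in> P" for f and A :: "('x \<Rightarrow>\<^sub>0 nat) set"
    using that by (auto simp: P_def coeff_sum intro!: sum_mem_mpol_ring)
  have "[:const c:] \<in> P" for c
    by (auto simp: P_def coeff_pCons const_mem_mpol_ring split: nat.split)
  moreover have "(\<Sum>j=0..s. monom (var (x, j)) j) \<in> P" if "x \<in> X" for x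
    using that by (auto simp: P_def coeff_sum jet_vars_def intro!: sum_mem_mpol_ring var_mem_mpol_ring)
  ultimately have "jet_subst s p \<in> P"
    unfolding jet_subst_def jet_monomial_def using assms
    by (intro sum mult power prod) (auto simp: mem_carrier_mpol_ring)
  then show ?thesis by (simp add: P_def)
qed

section \<open>The ideal of jets and its independence of generators\<close>

definition jet_coeffs :: "nat \<Rightarrow> ('x, 'k::field) mpol set \<Rightarrow> ('x \<times> nat, 'k) mpol set" where
  "jet_coeffs s F = {coeff (jet_subst s f) j | f j. f \<in> F \<and> j \<le> s}"

lemma jet_coeffs_carrier:
  "F \<subseteq> carrier (mpol_ring X) \<Longrightarrow> jet_coeffs s F \<subseteq> carrier (mpol_ring (jet_vars s X))"
  by (auto simp: jet_coeffs_def coeff_jet_subst_mem)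

text \<open>The polynomials whose coefficients up to \<open>s\<close> land in \<open>J\<close> form
  an ideal \<open>T\<close>, because coefficient \<open>j\<close> of a product involves only
  coefficients of the factors with index at most \<open>j\<close>. As \<open>T\<close> contains
  \<open>F\<close>, it contains the ideal generated by \<open>F\<close>.\<close>

lemma jet_coeffs_genideal:
  fixes F :: "('x, 'k::field) mpol set"
  assumes F: "F \<subseteq> carrier (mpol_ring X)"
  shows "jet_coeffs s (Idl\<^bsub>mpol_ring X\<^esub> F) \<subseteq> Idl\<^bsub>mpol_ring (jet_vars s X)\<^esub> (jet_coeffs s F)"
proof -
  define J where "J = Idl\<^bsub>mpol_ring (jet_vars s X)\<^esub> (jet_coeffs s F)"
  note J = mpol_genideal[OF jet_coeffs_carrier[OF F, of s], folded J_def]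
  define T where "T = {f \<in> carrier (mpol_ring X). \<forall>j\<le>s. coeff (jet_subst s f) j \<in> J}"
  have "ideal T (mpol_ring X)"
  proof (rule mpol_idealI)
    fix p q :: "('x, 'k) mpol" assume p: "p \<in> T" and q: "q \<in> carrier (mpol_ring X)"
    have "coeff (jet_subst s (q * p)) j \<in> J" if "j \<le> s" for j
      unfolding jet_subst_mult coeff_mult
      using p q that by (intro mpol_ideal_sum[OF J(1)] mpol_ideal_mult[OF J(1)])
        (auto simp: T_def coeff_jet_subst_mem)
    then show "q * p \<in> T" using p q by (auto simp: T_def mult_mem_mpol_ring)
  qed (auto simp: T_def jet_subst_add add_mem_mpol_ring
      intro: mpol_ideal_add[OF J(1)] mpol_ideal_zero[OF J(1)])
  moreover have "F \<subseteq> T" using F J(2) by (auto simp: T_def jet_coeffs_def)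
  ultimately have "Idl\<^bsub>mpol_ring X\<^esub> F \<subseteq> T" by (rule mpol_genideal_least)
  then show ?thesis by (auto simp: T_def jet_coeffs_def J_def)
qed

text \<open>The set picked by \<open>SOME\<close> generates the same ideal as \<open>F\<close>, so
  by \<open>jet_coeffs_genideal\<close> the jet coefficients of each lie in the ideal generated by
  those of the other.\<close>

lemma jets_ideal_genideal:
  fixes F :: "('x, 'k::field) mpol set"
  assumes F: "finite F" "F \<subseteq> carrier (mpol_ring X)"
  shows "jets_ideal s X (Idl\<^bsub>mpol_ring X\<^esub> F) = Idl\<^bsub>mpol_ring (jet_vars s X)\<^esub> (jet_coeffs s F)"
proof -
  define P where "P = (\<lambda>G :: ('x, 'k) mpol set. finite G \<and> G \<subseteq> carrier (mpol_ring X)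
    \<and> Idl\<^bsub>mpol_ring X\<^esub> F = Idl\<^bsub>mpol_ring X\<^esub> G)"
  define G where "G = (SOME G. P G)"
  have "P F" using F by (simp add: P_def)
  then have G: "G \<subseteq> carrier (mpol_ring X)" "Idl\<^bsub>mpol_ring X\<^esub> F = Idl\<^bsub>mpol_ring X\<^esub> G"
    using someI[of P F] by (simp_all add: G_def P_def)
  have *: "Idl\<^bsub>mpol_ring (jet_vars s X)\<^esub> (jet_coeffs s A) \<subseteq> Idl\<^bsub>mpol_ring (jet_vars s X)\<^esub> (jet_coeffs s B)"
    if A: "A \<subseteq> carrier (mpol_ring X)" and B: "B \<subseteq> carrier (mpol_ring X)"
      and "Idl\<^bsub>mpol_ring X\<^esub> A = Idl\<^bsub>mpol_ring X\<^esub> B" for A B :: "('x, 'k) mpol set"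
  proof (rule mpol_genideal_least)
    show "ideal (Idl\<^bsub>mpol_ring (jet_vars s X)\<^esub> (jet_coeffs s B)) (mpol_ring (jet_vars s X))"
      by (rule mpol_genideal(1)[OF jet_coeffs_carrier[OF B]])
    have "jet_coeffs s A \<subseteq> jet_coeffs s (Idl\<^bsub>mpol_ring X\<^esub> B)"
      using mpol_genideal(2)[OF A] that(3) by (fastforce simp: jet_coeffs_def)
    then show "jet_coeffs s A \<subseteq> Idl\<^bsub>mpol_ring (jet_vars s X)\<^esub> (jet_coeffs s B)"
      using jet_coeffs_genideal[OF B] by blast
  qed
  \<comment> \<open>The cutoff is invisible here because only coefficients of index at most
    \<open>s\<close> are taken.\<close>
  have "{coeff (jet_hom s f) j | f j. f \<in> G \<and> j \<le> s} = jet_coeffs s G"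
    unfolding jet_coeffs_def using coeff_jet_hom by metis
  then have "jets_ideal s X (Idl\<^bsub>mpol_ring X\<^esub> F) = Idl\<^bsub>mpol_ring (jet_vars s X)\<^esub> (jet_coeffs s G)"
    unfolding jets_ideal_def G_def P_def Let_def by simp
  then show ?thesis using *[OF G(1) F(2)] *[OF F(2) G(1)] G(2) by auto
qed

subsection \<open>The theorem of Goward and Smith\<close>

text \<open>
  With \<open>c\<^sub>k\<close> the sum of all monomials \<open>m\<^sub>h\<close> of weight \<open>k\<close>, multiply by one of them:
  every mixed product \<open>m\<^sub>h * m\<^sub>g\<close> is divisible by the monomial of the pointwise minimum of
  \<open>h\<close> and \<open>g\<close>, which has smaller weight, so by induction \<open>m\<^sub>h\<^sup>2\<close> is in the radical.
\<close>
lemma jet_monomial_mem_radical: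
  fixes J :: "('x \<times> nat, 'k::field) mpol set"
  assumes e: "finite e" "e \<subseteq> X" and J: "ideal J (mpol_ring (jet_vars s X))"
    and c: "\<And>k. k \<le> s \<Longrightarrow> coeff (jet_subst s (\<Prod>x\<in>e. var x)) k \<in> J"
    and h: "h \<in> e \<rightarrow>\<^sub>E {0..s}" "sum h e \<le> s"
  shows "(\<Prod>x\<in>e. var (x, h x)) \<in> ideal_radical (mpol_ring (jet_vars s X)) J"
  using h
proof (induction "sum h e" arbitrary: h rule: less_induct)
  case less
  let ?R = "ideal_radical (mpol_ring (jet_vars s X)) J"
  let ?m = "\<lambda>h. \<Prod>x\<in>e. var (x, h x) :: ('x \<times> nat, 'k) mpol"
  note R = ideal_mpol_radical[OF J]
  have mem: "?m g \<in> carrier (mpol_ring (jet_vars s X))" if "\<And>x. x \<in> e \<Longrightarrow> g x \<le> s" for g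
    using that e by (intro prod_mem_mpol_ring var_mem_mpol_ring) (auto simp: jet_vars_def)
  have mem_h: "?m h \<in> carrier (mpol_ring (jet_vars s X))"
    using less.prems by (intro mem) (auto simp: PiE_iff)
  define H where "H = {g. g \<in> e \<rightarrow>\<^sub>E {0..s} \<and> sum g e = sum h e}"
  have "finite H"
    unfolding H_def using e(1) by (intro finite_subset[OF _ finite_PiE[of e "\<lambda>_. {0..s}"]]) auto
  have mixed: "?m h * ?m g \<in> ?R" if g: "g \<in> H - {h}" for g
  proof -
    \<comment> \<open>The pointwise minimum, restricted to \<open>e\<close> so that it is
      extensional and the induction hypothesis applies.\<close>
    define a where "a = (\<lambda>x\<in>e. min (h x) (g x))"
    have a: "a \<in> e \<rightarrow>\<^sub>E {0..s}" using less.prems(1) by (auto simp: a_def PiE_iff)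
    have "g \<in> e \<rightarrow>\<^sub>E {0..s}" "g \<noteq> h" using g by (auto simp: H_def)
    then obtain y where y: "y \<in> e" "g y \<noteq> h y"
      using PiE_ext[OF _ less.prems(1)] by blast
    \<comment> \<open>As \<open>g\<close> and \<open>h\<close> differ but have equal weight,
      \<open>g\<close> cannot dominate \<open>h\<close>; where it drops below, the minimum is
      strictly smaller than \<open>h\<close>.\<close>
    have "\<exists>z\<in>e. g z < h z"
    proof (rule ccontr)
      assume "\<not> ?thesis"
      then have "\<forall>z\<in>e. h z \<le> g z" "h y < g y" using y by (auto simp: not_less le_neq_implies_less)
      then have "sum h e < sum g e" using y(1) e(1) by (auto intro: sum_strict_mono_ex1)
      then show False using g by (simp add: H_def)
    qed
    then have "sum a e < sum h e"
      using e(1) by (intro sum_strict_mono_ex1) (auto simp: a_def intro: min.strict_coboundedI2)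
    then have "?m a \<in> ?R" using less.hyps a less.prems by auto
    moreover have "?m (\<lambda>x. max (h x) (g x)) \<in> carrier (mpol_ring (jet_vars s X))"
      using g less.prems by (intro mem) (auto simp: H_def PiE_iff)
    ultimately have "?m (\<lambda>x. max (h x) (g x)) * ?m a \<in> ?R"
      by (rule mpol_ideal_mult[OF R])
    \<comment> \<open>At each vertex the maximum and the minimum are \<open>h x\<close> and
      \<open>g x\<close> in some order.\<close>
    moreover have "?m (\<lambda>x. max (h x) (g x)) * ?m a = ?m h * ?m g"
      unfolding prod.distrib[symmetric]
      by (rule prod.cong) (auto simp: a_def max_def min_def mult.commute)
    ultimately show ?thesis by simp
  qed
  have h_H: "h \<in> H" using less.prems by (simp add: H_def)
  \<comment> \<open>This sum is the coefficient of index \<open>sum h e\<close> of the jet of the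
    edge monomial.\<close>
  have "(\<Sum>g\<in>H. ?m g) \<in> J"
    using c[OF less.prems(2)] e(1) by (simp add: coeff_jet_subst_prod_var H_def)
  moreover have "J \<subseteq> ?R"
  proof
    fix p assume "p \<in> J"
    then have "p \<in> carrier (mpol_ring (jet_vars s X))" "p ^ 1 \<in> J"
      using mpol_ideal_subset[OF J] by auto
    then show "p \<in> ?R" unfolding mem_mpol_radical using zero_less_one by blast
  qed
  ultimately have prod: "?m h * (\<Sum>g\<in>H. ?m g) \<in> ?R"
    using mem_h by (intro mpol_ideal_mult[OF R]) auto
  have "?m h * (\<Sum>g\<in>H. ?m g) = ?m h * ?m h + (\<Sum>g\<in>H-{h}. ?m h * ?m g)"
    using \<open>finite H\<close> h_H by (simp add: sum_distrib_left sum.remove distrib_left)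
  then have "?m h * ?m h = ?m h * (\<Sum>g\<in>H. ?m g) - (\<Sum>g\<in>H-{h}. ?m h * ?m g)"
    by (simp only: add_diff_cancel_right')
  also have "\<dots> \<in> ?R"
    by (rule mpol_ideal_diff[OF R prod mpol_ideal_sum[OF R mixed]])
  finally have "?m h * ?m h \<in> ?R" .
  then show ?case by (rule mpol_radical_power2[OF mem_h])
qed

text \<open>The edges described by Goward and Smith, with the same index functions as in the
  expansion \<open>coeff_jet_subst_prod_var\<close>.\<close>

definition jet_edges :: "nat \<Rightarrow> 'x set set \<Rightarrow> ('x \<times> nat) set set" where
  "jet_edges s E = {(\<lambda>x. (x, h x)) ` e | e h. e \<in> E \<and> h \<in> e \<rightarrow>\<^sub>E {0..s} \<and> sum h e \<le> s}"

text \<open>Jet edges are graphs of functions: inclusion of graphs gives equal values and inclusion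
  of the underlying edges, which then agree because \<open>E\<close> is a clutter.\<close>

lemma clutter_jet_edges:
  assumes "clutter X E"
  shows "clutter (jet_vars s X) (jet_edges s E)"
proof -
  have "a = b" if ab: "a \<in> jet_edges s E" "b \<in> jet_edges s E" "a \<subseteq> b" for a b
  proof -
    obtain e h where a: "a = (\<lambda>x. (x, h x)) ` e" "e \<in> E" using ab by (auto simp: jet_edges_def)
    obtain f g where b: "b = (\<lambda>x. (x, g x)) ` f" "f \<in> E" using ab by (auto simp: jet_edges_def)
    have "e \<subseteq> f" "\<forall>x\<in>e. h x = g x" using ab(3) by (auto simp: a b)
    moreover from this have "e = f" using assms a b by (auto simp: clutter_def)
    ultimately show ?thesis by (auto simp: a b)
  qed
  moreover have "a \<subseteq> jet_vars s X" if "a \<in> jet_edges s E" for a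
    using that assms by (fastforce simp: jet_edges_def jet_vars_def clutter_def PiE_iff)
  ultimately show ?thesis by (auto simp: clutter_def)
qed

lemma prod_graph_var: "(\<Prod>v\<in>(\<lambda>x. (x, h x)) ` e. var v) = (\<Prod>x\<in>e. var (x, h x))"
  by (subst prod.reindex) (auto simp: inj_on_def)

text \<open>The monomials of jet edges lie in the radical by
  \<open>jet_monomial_mem_radical\<close>. Conversely, the generators of the ideal of jets are sums
  of such monomials, and the ideal these generate is already radical.\<close>

theorem radical_jets_ideal:
  assumes X: "finite X" and E: "clutter X E"
  shows "ideal_radical (mpol_ring (jet_vars s X)) (jets_ideal s X (edge_ideal X E))
    = (edge_ideal (jet_vars s X) (jet_edges s E) :: ('x \<times> nat, 'k::field) mpol set)"
    (is "ideal_radical ?R ?J = ?M")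
proof
  let ?G = "(\<lambda>e. \<Prod>x\<in>e. var x :: ('x, 'k) mpol) ` E"
  have E_sub: "E \<subseteq> Pow X" using E by (auto simp: clutter_def)
  then have fin_E: "finite E" "\<And>e. e \<in> E \<Longrightarrow> finite e"
    using X by (auto intro: finite_subset[of _ X] finite_subset[of E "Pow X"])
  have G: "?G \<subseteq> carrier (mpol_ring X)" using E_sub by (auto intro: prod_var_mem_mpol_ring)
  have J_eq: "?J = Idl\<^bsub>?R\<^esub> (jet_coeffs s ?G)"
    unfolding edge_ideal_def using fin_E G by (intro jets_ideal_genideal) auto
  note J = mpol_genideal[OF jet_coeffs_carrier[OF G, of s], folded J_eq]
  have fin: "finite (jet_vars s X)" using X by (simp add: jet_vars_def)
  have sub: "\<forall>e\<in>jet_edges s E. e \<subseteq> jet_vars s X"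
    using clutter_jet_edges[OF E] by (auto simp: clutter_def)
  let ?H = "(\<lambda>e. \<Prod>x\<in>e. var x :: ('x \<times> nat, 'k) mpol) ` jet_edges s E"
  have H: "?H \<subseteq> carrier ?R" using sub by (auto intro: prod_var_mem_mpol_ring)
  note M = mpol_genideal[OF H, folded edge_ideal_def]
  show "?M \<subseteq> ideal_radical ?R ?J"
    unfolding edge_ideal_def[of "jet_vars s X"]
  proof (rule mpol_genideal_least[OF ideal_mpol_radical[OF J(1)]])
    show "?H \<subseteq> ideal_radical ?R ?J"
    proof
      fix p assume "p \<in> ?H"
      then obtain e h where e: "e \<in> E" and h: "h \<in> e \<rightarrow>\<^sub>E {0..s}" "sum h e \<le> s"
        and p: "p = (\<Prod>x\<in>e. var (x, h x))"
        by (auto simp: jet_edges_def prod_graph_var)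
      show "p \<in> ideal_radical ?R ?J"
        unfolding p
      proof (rule jet_monomial_mem_radical[OF fin_E(2)[OF e] _ J(1) _ h])
        show "coeff (jet_subst s (\<Prod>x\<in>e. var x)) k \<in> ?J" if "k \<le> s" for k
          using J(2) e that by (auto simp: jet_coeffs_def)
      qed (use e E_sub in auto)
    qed
  qed
  have "jet_coeffs s ?G \<subseteq> ?M"
  proof
    fix p assume "p \<in> jet_coeffs s ?G"
    then obtain e k where e: "e \<in> E" and k: "k \<le> s" and p: "p = coeff (jet_subst s (\<Prod>x\<in>e. var x)) k"
      by (auto simp: jet_coeffs_def)
    show "p \<in> ?M"
      unfolding p coeff_jet_subst_prod_var[OF fin_E(2)[OF e]]
    proof (rule mpol_ideal_sum[OF M(1)])
      fix h assume "h \<in> {h. h \<in> e \<rightarrow>\<^sub>E {0..s} \<and> sum h e = k}"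
      then have "(\<lambda>x. (x, h x)) ` e \<in> jet_edges s E" using e k by (auto simp: jet_edges_def)
      then have "(\<Prod>v\<in>(\<lambda>x. (x, h x)) ` e. var v) \<in> ?M" using M(2) by blast
      then show "(\<Prod>x\<in>e. var (x, h x)) \<in> ?M" by (simp only: prod_graph_var)
    qed
  qed
  then have "?J \<subseteq> ?M" unfolding J_eq by (rule mpol_genideal_least[OF M(1)])
  then have "ideal_radical ?R ?J \<subseteq> ideal_radical ?R ?M" unfolding ideal_radical_def by blast
  then show "ideal_radical ?R ?J \<subseteq> ?M" using radical_edge_ideal[OF fin sub] by blast
qed

text \<open>\<open>radical_jets_ideal\<close> shows that \<open>jet_edges\<close> fits the defining
  description, and \<open>clutter_edge_ideal_inject\<close> that nothing else does.\<close>

lemma jets_edges_eq: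
  assumes X: "finite X" and E: "clutter X E"
  shows "jets_edges TYPE('k::field) s X E = jet_edges s E"
  unfolding jets_edges_def radical_jets_ideal[OF assms]
proof (rule the_equality)
  show "clutter (jet_vars s X) (jet_edges s E) \<and>
      (edge_ideal (jet_vars s X) (jet_edges s E) :: ('a \<times> nat, 'k) mpol set)
        = edge_ideal (jet_vars s X) (jet_edges s E)"
    using clutter_jet_edges[OF E] by simp
next
  fix D assume D: "clutter (jet_vars s X) D \<and>
      (edge_ideal (jet_vars s X) D :: ('a \<times> nat, 'k) mpol set)
        = edge_ideal (jet_vars s X) (jet_edges s E)"
  have "finite (jet_vars s X)" using X by (simp add: jet_vars_def)
  then show "D = jet_edges s E"
    using clutter_edge_ideal_inject[OF _ _ clutter_jet_edges[OF E]] D by blast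
qed

section \<open>Lowering an index inside a minimal vertex cover\<close>

theorem lemma3p1:
  fixes X :: "'x set" and E :: "'x set set" and s i j :: nat
    and W :: "('x \<times> nat) set" and x :: 'x
  assumes "finite X" and "clutter X E"
    and "minimal_vertex_cover (jet_vars s X) (jets_edges TYPE('k::field) s X E) W"
    and "x \<in> X" and "i \<in> {0..s}" and "(x, i) \<in> W"
    and "j \<in> {0..i}"
  shows "(x, j) \<in> W"
proof -
  have W: "minimal_vertex_cover (jet_vars s X) (jet_edges s E) W"
    using assms(3) by (simp add: jets_edges_eq[OF assms(1,2)])
  then have cover: "W \<subseteq> jet_vars s X" "\<And>a. a \<in> jet_edges s E \<Longrightarrow> W \<inter> a \<noteq> {}"
    by (auto simp: minimal_vertex_cover_def vertex_cover_def)
  have "\<not> vertex_cover (jet_vars s X) (jet_edges s E) (W - {(x, i)})"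
    using W assms(6) by (auto simp: minimal_vertex_cover_def)
  then obtain a where a: "a \<in> jet_edges s E" "(W - {(x, i)}) \<inter> a = {}"
    using cover(1) by (auto simp: vertex_cover_def)
  then obtain e h where e: "e \<in> E" and h: "h \<in> e \<rightarrow>\<^sub>E {0..s}" "sum h e \<le> s"
    and a_eq: "a = (\<lambda>y. (y, h y)) ` e"
    by (auto simp: jet_edges_def)
  \<comment> \<open>\<open>W\<close> meets \<open>a\<close>, but no longer does so once
    \<open>(x, i)\<close> is removed.\<close>
  have "(x, i) \<in> a" using cover(2)[OF a(1)] a(2) by blast
  then have x: "x \<in> e" "h x = i" by (auto simp: a_eq)
  have "sum (h(x := j)) e \<le> sum h e"
    using x assms(7) by (intro sum_mono) auto
  \<comment> \<open>The update happens at a point of \<open>e\<close>, so the new function stays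
    extensional; its values stay within \<open>s\<close> since \<open>j \<le> i\<close> and
    \<open>i \<le> s\<close>.\<close>
  then have "(\<lambda>y. (y, (h(x := j)) y)) ` e \<in> jet_edges s E"
    using e h x assms(5,7)
    by (auto simp: jet_edges_def PiE_iff extensional_def
        intro!: exI[of _ e] exI[of _ "h(x := j)"])
  then obtain y where y: "y \<in> e" "(y, (h(x := j)) y) \<in> W"
    using cover(2) by blast
  \<comment> \<open>Away from \<open>x\<close> the two jet edges agree, so a meeting point there
    would already lie in \<open>a\<close> and in \<open>W\<close> without
    \<open>(x, i)\<close>.\<close>
  have "y = x"
  proof (rule ccontr)
    assume "y \<noteq> x"
    then have "(y, h y) \<in> (W - {(x, i)}) \<inter> a" using y by (auto simp: a_eq)
    then show False using a(2) by blast
  qed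
  then show ?thesis using y by simp
qed

end
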